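(* Let $\mathsf{Counter}$ be the record type $\{\mathsf{incr} : \mathsf{T}\,\mathsf{unit};\ \mathsf{read} : \mathsf{T}\,\mathsf{Int}\}$ and define the closed terms $$\mathsf{posCounter} :\equiv \ell\gets \mathsf{alloc}\,0;\ \mathsf{ret}\,\{\mathsf{incr}\hookrightarrow i\gets \mathsf{get}\,\ell;\ \mathsf{set}\,\ell\,(i+1),\ \mathsf{read}\hookrightarrow \mathsf{get}\,\ell\},$$ $$\mathsf{negCounter} :\equiv \ell\gets \mathsf{alloc}\,0;\ \mathsf{ret}\,\{\mathsf{incr}\hookrightarrow i\gets \mathsf{get}\,\ell;\ \mathsf{set}\,\ell\,(i-1),\ \mathsf{read}\hookrightarrow \mathsf{map}\,\mathsf{neg}\,(\mathsf{get}\,\ell)\},$$ where $\mathsf{neg}:\mathsf{Int}\to\mathsf{Int}$ is negation. Then the equation $\vdash \mathsf{posCounter}\equiv\mathsf{negCounter}$ is derivable in the equational theory of univalent reference types (at type $\mathsf{T}\,\mathsf{Counter}$).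
   Context: The language is a monadic metalanguage: a simply typed $\lambda$-calculus with function, unit, product (and record) types and a type $\mathsf{Int}$ of integers with the usual arithmetic operations ($+$, $-$, negation $\mathsf{neg}$) and their standard equations, together with a strong monad $\mathsf{T}$ (notation: $x\gets e; e'$ for bind, $e;e'$ for $\_\gets e;e'$, $\mathsf{ret}$ for the unit, and $\mathsf{map}\,f:\mathsf{T}\,A\to\mathsf{T}\,B$ for the functorial action of $\mathsf{T}$ on $f:A\to B$), and a type former $\mathsf{Ref}\,\tau$ of references. Typing rules: if $\Gamma\vdash e:\sigma$ then $\Gamma\vdash\mathsf{alloc}\,e:\mathsf{T}(\mathsf{Ref}\,\sigma)$; if $\Gamma\vdash e:\mathsf{Ref}\,\sigma$ then $\Gamma\vdash\mathsf{get}\,e:\mathsf{T}\,\sigma$; if $\Gamma\vdash e:\mathsf{Ref}\,\sigma$ and $\Gamma\vdash e':\sigma$ then $\Gamma\vdash \mathsf{set}\,e\,e':\mathsf{T}\,\mathsf{unit}$; $\Gamma\vdash\mathsf{step}:\mathsf{T}\,\mathsf{unit}$; and if $\Gamma,f:\sigma\to\mathsf{T}\tau,x:\sigma\vdash e:\mathsf{T}\tau$ then $\Gamma\vdash \mathsf{rec}\,f\,x.\,e:\sigma\to\mathsf{T}\tau$. The base equational theory consists of: the $\beta\eta$-laws for function and product types; the monad laws; centrality of $\mathsf{step}$ (it commutes with all monadic operations); $(\mathsf{rec}\,f\,x.\,e)\,e'\equiv \mathsf{step};[(\mathsf{rec}\,f\,x.\,e)/f,e'/x]e$; and for $e:\mathsf{Ref}\,\sigma$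 etc.: $\mathsf{set}\,e\,e';\mathsf{get}\,e\equiv\mathsf{step};\mathsf{set}\,e\,e';\mathsf{ret}\,e'$; $(x\gets\mathsf{alloc}\,e;\mathsf{set}\,x\,e)\equiv\mathsf{alloc}\,e$; $\mathsf{set}\,e\,e';\mathsf{set}\,e\,e''\equiv\mathsf{set}\,e\,e''$; $(x\gets\mathsf{get}\,e;y\gets\mathsf{get}\,e';\mathsf{ret}\langle x,y\rangle)\equiv(y\gets\mathsf{get}\,e';x\gets\mathsf{get}\,e;\mathsf{ret}\langle x,y\rangle)$; $(x\gets\mathsf{get}\,e;\mathsf{set}\,e\,x)\equiv\mathsf{get}\,e$; and $\mathsf{get}\,e;e'\equiv\mathsf{step};e'$ for $e':\mathsf{T}\tau$. The theory of univalent reference types adds two rules. Allocation permutation: for $\Gamma\vdash e:\sigma$, $\Gamma\vdash e':\tau$, $\ell\gets\mathsf{alloc}\,e;\ell'\gets\mathsf{alloc}\,e';\mathsf{ret}\langle\ell,\ell'\rangle\equiv\ell'\gets\mathsf{alloc}\,e';\ell\gets\mathsf{alloc}\,e;\mathsf{ret}\langle\ell,\ell'\rangle : \mathsf{T}(\mathsf{Ref}\,\sigma\times\mathsf{Ref}\,\tau)$. Representation independence: writing $\mathsf{Cell}\,\sigma:\equiv\mathsf{T}\,\sigma\times(\sigma\to\mathsf{T}\,\mathsf{unit})$, if $\Gamma\vdash e:\sigma$, $\Gamma\vdash f^+:\sigma\to\tau$, $\Gamma\vdash f^-:\tau\to\sigma$ with $f^+(f^-x)\equiv x$ and $f^-(f^+x)\equiv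 x$, then $\ell\gets\mathsf{alloc}\,e;\mathsf{ret}\langle\mathsf{get}\,\ell,\mathsf{set}\,\ell\rangle\equiv\ell\gets\mathsf{alloc}\,(f^+e);\mathsf{ret}\langle\mathsf{map}\,f^-(\mathsf{get}\,\ell),\ \mathsf{set}\,\ell\circ f^+\rangle:\mathsf{T}(\mathsf{Cell}\,\sigma)$. *)

theory Defs
  imports "HOL-Library.Finite_Map"
begin

section \<open>Types and terms\<close>

text \<open>
  Record types and records are finite maps from field labels, so the order of the fields is
  irrelevant and labels are automatically distinct.
\<close>

datatype ty =
    UnitT
  | IntT
  | Fun ty ty  (infixr \<open>\<rightarrow>\<close> 70)
  | Prod ty ty  (infixr \<open>\<otimes>\<close> 75)
  | RecT "(string, ty) fmap"
  | T ty
  | Ref ty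

text \<open>
  Terms are in de Bruijn notation: \<open>Lam \<sigma> e\<close> binds \<open>0\<close> in \<open>e\<close>; \<open>Bind e e'\<close>, written
  \<open>x \<leftarrow> e; e'\<close> with names, binds \<open>0\<close> in \<open>e'\<close>; \<open>Rec \<sigma> \<tau> e\<close>, written \<open>rec f x. e\<close>, binds the
  argument \<open>x\<close> as \<open>0\<close> and the function \<open>f\<close> as \<open>1\<close> in \<open>e\<close>.  The annotations on \<open>Lam\<close> and
  \<open>Rec\<close> make the type of a term unique.
\<close>

datatype tm =
    Var nat
  | Lam ty tm
  | App tm tm
  | Star
  | Tup tm tm
  | Fst tm
  | Snd tm
  | Rcd "(string, tm) fmap"
  | Sel tm string
  | Lit int
  | Plus tm tm
  | Minus tm tm
  | Neg
  | Ret tm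
  | Bind tm tm
  | Alloc tm
  | Get tm
  | Set tm tm
  | Step
  | Rec ty ty tm

section \<open>Renaming and substitution\<close>

definition lift_ren :: "(nat \<Rightarrow> nat) \<Rightarrow> nat \<Rightarrow> nat" where
  "lift_ren r = case_nat 0 (\<lambda>n. Suc (r n))"

primrec rename :: "(nat \<Rightarrow> nat) \<Rightarrow> tm \<Rightarrow> tm" where
  "rename r (Var n) = Var (r n)"
| "rename r (Lam \<sigma> e) = Lam \<sigma> (rename (lift_ren r) e)"
| "rename r (App e e') = App (rename r e) (rename r e')"
| "rename r Star = Star"
| "rename r (Tup e e') = Tup (rename r e) (rename r e')"
| "rename r (Fst e) = Fst (rename r e)"
| "rename r (Snd e) = Snd (rename r e)"
| "rename r (Rcd fs) = Rcd (fmmap (rename r) fs)"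
| "rename r (Sel e l) = Sel (rename r e) l"
| "rename r (Lit k) = Lit k"
| "rename r (Plus e e') = Plus (rename r e) (rename r e')"
| "rename r (Minus e e') = Minus (rename r e) (rename r e')"
| "rename r Neg = Neg"
| "rename r (Ret e) = Ret (rename r e)"
| "rename r (Bind e e') = Bind (rename r e) (rename (lift_ren r) e')"
| "rename r (Alloc e) = Alloc (rename r e)"
| "rename r (Get e) = Get (rename r e)"
| "rename r (Set e e') = Set (rename r e) (rename r e')"
| "rename r Step = Step"
| "rename r (Rec \<sigma> \<tau> e) = Rec \<sigma> \<tau> (rename (lift_ren (lift_ren r)) e)"

abbreviation shift :: "tm \<Rightarrow> tm" where
  "shift \<equiv> rename Suc"

definition lift_sub :: "(nat \<Rightarrow> tm) \<Rightarrow> nat \<Rightarrow> tm" where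
  "lift_sub s = case_nat (Var 0) (\<lambda>n. shift (s n))"

primrec subst :: "(nat \<Rightarrow> tm) \<Rightarrow> tm \<Rightarrow> tm" where
  "subst s (Var n) = s n"
| "subst s (Lam \<sigma> e) = Lam \<sigma> (subst (lift_sub s) e)"
| "subst s (App e e') = App (subst s e) (subst s e')"
| "subst s Star = Star"
| "subst s (Tup e e') = Tup (subst s e) (subst s e')"
| "subst s (Fst e) = Fst (subst s e)"
| "subst s (Snd e) = Snd (subst s e)"
| "subst s (Rcd fs) = Rcd (fmmap (subst s) fs)"
| "subst s (Sel e l) = Sel (subst s e) l"
| "subst s (Lit k) = Lit k"
| "subst s (Plus e e') = Plus (subst s e) (subst s e')"
| "subst s (Minus e e') = Minus (subst s e) (subst s e')"
| "subst s Neg = Neg"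
| "subst s (Ret e) = Ret (subst s e)"
| "subst s (Bind e e') = Bind (subst s e) (subst (lift_sub s) e')"
| "subst s (Alloc e) = Alloc (subst s e)"
| "subst s (Get e) = Get (subst s e)"
| "subst s (Set e e') = Set (subst s e) (subst s e')"
| "subst s Step = Step"
| "subst s (Rec \<sigma> \<tau> e) = Rec \<sigma> \<tau> (subst (lift_sub (lift_sub s)) e)"

abbreviation inst :: "tm \<Rightarrow> tm \<Rightarrow> tm" where
  "inst u \<equiv> subst (case_nat u Var)"

abbreviation inst2 :: "tm \<Rightarrow> tm \<Rightarrow> tm \<Rightarrow> tm" where
  "inst2 f u \<equiv> subst (case_nat u (case_nat f Var))"

section \<open>Derived forms\<close>

abbreviation seq :: "tm \<Rightarrow> tm \<Rightarrow> tm"  (infixr \<open>;;\<close> 60) where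
  "e ;; e' \<equiv> Bind e (shift e')"

definition mapT :: "tm \<Rightarrow> tm \<Rightarrow> tm" where
  "mapT f e = Bind e (Ret (App (shift f) (Var 0)))"

text \<open>\<open>comp \<sigma> g f\<close> is the composite of \<open>g\<close> after \<open>f\<close>, where \<open>\<sigma>\<close> is the domain of \<open>f\<close>.\<close>

definition comp :: "ty \<Rightarrow> tm \<Rightarrow> tm \<Rightarrow> tm" where
  "comp \<sigma> g f = Lam \<sigma> (App (shift g) (App (shift f) (Var 0)))"

text \<open>The partial application of \<open>set\<close> to a reference \<open>e\<close> with contents of type \<open>\<sigma>\<close>.\<close>

definition setf :: "ty \<Rightarrow> tm \<Rightarrow> tm" where
  "setf \<sigma> e = Lam \<sigma> (Set (shift e) (Var 0))"

definition Cell :: "ty \<Rightarrow> ty" where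
  "Cell \<sigma> = T \<sigma> \<otimes> (\<sigma> \<rightarrow> T UnitT)"

section \<open>Typing\<close>

inductive typing :: "ty list \<Rightarrow> tm \<Rightarrow> ty \<Rightarrow> bool"  (\<open>_ \<turnstile> _ \<Colon> _\<close> [51, 51, 51] 50) where
  Var: "n < length \<Gamma> \<Longrightarrow> \<Gamma> \<turnstile> Var n \<Colon> \<Gamma> ! n"
| Lam: "\<sigma> # \<Gamma> \<turnstile> e \<Colon> \<tau> \<Longrightarrow> \<Gamma> \<turnstile> Lam \<sigma> e \<Colon> \<sigma> \<rightarrow> \<tau>"
| App: "\<Gamma> \<turnstile> e \<Colon> \<sigma> \<rightarrow> \<tau> \<Longrightarrow> \<Gamma> \<turnstile> e' \<Colon> \<sigma> \<Longrightarrow> \<Gamma> \<turnstile> App e e' \<Colon> \<tau>"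
| Star: "\<Gamma> \<turnstile> Star \<Colon> UnitT"
| Tup: "\<Gamma> \<turnstile> e \<Colon> \<sigma> \<Longrightarrow> \<Gamma> \<turnstile> e' \<Colon> \<tau> \<Longrightarrow> \<Gamma> \<turnstile> Tup e e' \<Colon> \<sigma> \<otimes> \<tau>"
| Fst: "\<Gamma> \<turnstile> e \<Colon> \<sigma> \<otimes> \<tau> \<Longrightarrow> \<Gamma> \<turnstile> Fst e \<Colon> \<sigma>"
| Snd: "\<Gamma> \<turnstile> e \<Colon> \<sigma> \<otimes> \<tau> \<Longrightarrow> \<Gamma> \<turnstile> Snd e \<Colon> \<tau>"
| Rcd: "fmrel (\<lambda>e \<tau>. \<Gamma> \<turnstile> e \<Colon> \<tau>) fs Fs \<Longrightarrow> \<Gamma> \<turnstile> Rcd fs \<Colon> RecT Fs"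
| Sel: "\<Gamma> \<turnstile> e \<Colon> RecT Fs \<Longrightarrow> fmlookup Fs l = Some \<tau> \<Longrightarrow> \<Gamma> \<turnstile> Sel e l \<Colon> \<tau>"
| Lit: "\<Gamma> \<turnstile> Lit k \<Colon> IntT"
| Plus: "\<Gamma> \<turnstile> e \<Colon> IntT \<Longrightarrow> \<Gamma> \<turnstile> e' \<Colon> IntT \<Longrightarrow> \<Gamma> \<turnstile> Plus e e' \<Colon> IntT"
| Minus: "\<Gamma> \<turnstile> e \<Colon> IntT \<Longrightarrow> \<Gamma> \<turnstile> e' \<Colon> IntT \<Longrightarrow> \<Gamma> \<turnstile> Minus e e' \<Colon> IntT"
| Neg: "\<Gamma> \<turnstile> Neg \<Colon> IntT \<rightarrow> IntT"
| Ret: "\<Gamma> \<turnstile> e \<Colon> \<sigma> \<Longrightarrow> \<Gamma> \<turnstile> Ret e \<Colon> T \<sigma>"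
| Bind: "\<Gamma> \<turnstile> e \<Colon> T \<sigma> \<Longrightarrow> \<sigma> # \<Gamma> \<turnstile> e' \<Colon> T \<tau> \<Longrightarrow> \<Gamma> \<turnstile> Bind e e' \<Colon> T \<tau>"
| Alloc: "\<Gamma> \<turnstile> e \<Colon> \<sigma> \<Longrightarrow> \<Gamma> \<turnstile> Alloc e \<Colon> T (Ref \<sigma>)"
| Get: "\<Gamma> \<turnstile> e \<Colon> Ref \<sigma> \<Longrightarrow> \<Gamma> \<turnstile> Get e \<Colon> T \<sigma>"
| Set: "\<Gamma> \<turnstile> e \<Colon> Ref \<sigma> \<Longrightarrow> \<Gamma> \<turnstile> e' \<Colon> \<sigma> \<Longrightarrow> \<Gamma> \<turnstile> Set e e' \<Colon> T UnitT"
| Step: "\<Gamma> \<turnstile> Step \<Colon> T UnitT"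
| Rec: "\<sigma> # (\<sigma> \<rightarrow> T \<tau>) # \<Gamma> \<turnstile> e \<Colon> T \<tau> \<Longrightarrow> \<Gamma> \<turnstile> Rec \<sigma> \<tau> e \<Colon> \<sigma> \<rightarrow> T \<tau>"

section \<open>The equational theory of univalent reference types\<close>

text \<open>
  The laws \<open>alloc_set\<close> and \<open>get_set\<close> carry a final \<open>ret x\<close>: the usual shorthands
  \<open>(x \<leftarrow> alloc e; set x e) \<equiv> alloc e\<close> and \<open>(x \<leftarrow> get e; set e x) \<equiv> get e\<close> have sides of
  different types.
\<close>

inductive equ :: "ty list \<Rightarrow> tm \<Rightarrow> tm \<Rightarrow> ty \<Rightarrow> bool"  (\<open>_ \<turnstile> _ \<approx> _ \<Colon> _\<close> [51, 51, 51, 51] 50) where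
  \<comment> \<open>equivalence\<close>
  refl: "\<Gamma> \<turnstile> e \<Colon> \<tau> \<Longrightarrow> \<Gamma> \<turnstile> e \<approx> e \<Colon> \<tau>"
| sym: "\<Gamma> \<turnstile> e \<approx> e' \<Colon> \<tau> \<Longrightarrow> \<Gamma> \<turnstile> e' \<approx> e \<Colon> \<tau>"
| trans: "\<Gamma> \<turnstile> e \<approx> e' \<Colon> \<tau> \<Longrightarrow> \<Gamma> \<turnstile> e' \<approx> e'' \<Colon> \<tau> \<Longrightarrow> \<Gamma> \<turnstile> e \<approx> e'' \<Colon> \<tau>"
  \<comment> \<open>congruence\<close>
| cong_Lam: "\<sigma> # \<Gamma> \<turnstile> e \<approx> d \<Colon> \<tau> \<Longrightarrow> \<Gamma> \<turnstile> Lam \<sigma> e \<approx> Lam \<sigma> d \<Colon> \<sigma> \<rightarrow> \<tau>"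
| cong_App: "\<Gamma> \<turnstile> e \<approx> d \<Colon> \<sigma> \<rightarrow> \<tau> \<Longrightarrow> \<Gamma> \<turnstile> e' \<approx> d' \<Colon> \<sigma> \<Longrightarrow> \<Gamma> \<turnstile> App e e' \<approx> App d d' \<Colon> \<tau>"
| cong_Tup: "\<Gamma> \<turnstile> e \<approx> d \<Colon> \<sigma> \<Longrightarrow> \<Gamma> \<turnstile> e' \<approx> d' \<Colon> \<tau> \<Longrightarrow> \<Gamma> \<turnstile> Tup e e' \<approx> Tup d d' \<Colon> \<sigma> \<otimes> \<tau>"
| cong_Fst: "\<Gamma> \<turnstile> e \<approx> d \<Colon> \<sigma> \<otimes> \<tau> \<Longrightarrow> \<Gamma> \<turnstile> Fst e \<approx> Fst d \<Colon> \<sigma>"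
| cong_Snd: "\<Gamma> \<turnstile> e \<approx> d \<Colon> \<sigma> \<otimes> \<tau> \<Longrightarrow> \<Gamma> \<turnstile> Snd e \<approx> Snd d \<Colon> \<tau>"
| cong_Rcd: "fmdom fs = fmdom Fs \<Longrightarrow> fmdom gs = fmdom Fs \<Longrightarrow>
    (\<And>l e d \<tau>. fmlookup fs l = Some e \<Longrightarrow> fmlookup gs l = Some d \<Longrightarrow> fmlookup Fs l = Some \<tau> \<Longrightarrow>
      \<Gamma> \<turnstile> e \<approx> d \<Colon> \<tau>) \<Longrightarrow>
    \<Gamma> \<turnstile> Rcd fs \<approx> Rcd gs \<Colon> RecT Fs"
| cong_Sel: "\<Gamma> \<turnstile> e \<approx> d \<Colon> RecT Fs \<Longrightarrow> fmlookup Fs l = Some \<tau> \<Longrightarrow> \<Gamma> \<turnstile> Sel e l \<approx> Sel d l \<Colon> \<tau>"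
| cong_Plus: "\<Gamma> \<turnstile> e \<approx> d \<Colon> IntT \<Longrightarrow> \<Gamma> \<turnstile> e' \<approx> d' \<Colon> IntT \<Longrightarrow> \<Gamma> \<turnstile> Plus e e' \<approx> Plus d d' \<Colon> IntT"
| cong_Minus: "\<Gamma> \<turnstile> e \<approx> d \<Colon> IntT \<Longrightarrow> \<Gamma> \<turnstile> e' \<approx> d' \<Colon> IntT \<Longrightarrow> \<Gamma> \<turnstile> Minus e e' \<approx> Minus d d' \<Colon> IntT"
| cong_Ret: "\<Gamma> \<turnstile> e \<approx> d \<Colon> \<sigma> \<Longrightarrow> \<Gamma> \<turnstile> Ret e \<approx> Ret d \<Colon> T \<sigma>"
| cong_Bind: "\<Gamma> \<turnstile> e \<approx> d \<Colon> T \<sigma> \<Longrightarrow> \<sigma> # \<Gamma> \<turnstile> e' \<approx> d' \<Colon> T \<tau> \<Longrightarrow> \<Gamma> \<turnstile> Bind e e' \<approx> Bind d d' \<Colon> T \<tau>"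
| cong_Alloc: "\<Gamma> \<turnstile> e \<approx> d \<Colon> \<sigma> \<Longrightarrow> \<Gamma> \<turnstile> Alloc e \<approx> Alloc d \<Colon> T (Ref \<sigma>)"
| cong_Get: "\<Gamma> \<turnstile> e \<approx> d \<Colon> Ref \<sigma> \<Longrightarrow> \<Gamma> \<turnstile> Get e \<approx> Get d \<Colon> T \<sigma>"
| cong_Set: "\<Gamma> \<turnstile> e \<approx> d \<Colon> Ref \<sigma> \<Longrightarrow> \<Gamma> \<turnstile> e' \<approx> d' \<Colon> \<sigma> \<Longrightarrow> \<Gamma> \<turnstile> Set e e' \<approx> Set d d' \<Colon> T UnitT"
| cong_Rec: "\<sigma> # (\<sigma> \<rightarrow> T \<tau>) # \<Gamma> \<turnstile> e \<approx> d \<Colon> T \<tau> \<Longrightarrow> \<Gamma> \<turnstile> Rec \<sigma> \<tau> e \<approx> Rec \<sigma> \<tau> d \<Colon> \<sigma> \<rightarrow> T \<tau>"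
  \<comment> \<open>\<open>\<beta>\<eta>\<close>-laws for function, unit, product and record types\<close>
| Fun_beta: "\<sigma> # \<Gamma> \<turnstile> e \<Colon> \<tau> \<Longrightarrow> \<Gamma> \<turnstile> e' \<Colon> \<sigma> \<Longrightarrow> \<Gamma> \<turnstile> App (Lam \<sigma> e) e' \<approx> inst e' e \<Colon> \<tau>"
| Fun_eta: "\<Gamma> \<turnstile> e \<Colon> \<sigma> \<rightarrow> \<tau> \<Longrightarrow> \<Gamma> \<turnstile> e \<approx> Lam \<sigma> (App (shift e) (Var 0)) \<Colon> \<sigma> \<rightarrow> \<tau>"
| Unit_eta: "\<Gamma> \<turnstile> e \<Colon> UnitT \<Longrightarrow> \<Gamma> \<turnstile> e \<approx> Star \<Colon> UnitT"
| Prod_beta1: "\<Gamma> \<turnstile> e \<Colon> \<sigma> \<Longrightarrow> \<Gamma> \<turnstile> e' \<Colon> \<tau> \<Longrightarrow> \<Gamma> \<turnstile> Fst (Tup e e') \<approx> e \<Colon> \<sigma>"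
| Prod_beta2: "\<Gamma> \<turnstile> e \<Colon> \<sigma> \<Longrightarrow> \<Gamma> \<turnstile> e' \<Colon> \<tau> \<Longrightarrow> \<Gamma> \<turnstile> Snd (Tup e e') \<approx> e' \<Colon> \<tau>"
| Prod_eta: "\<Gamma> \<turnstile> e \<Colon> \<sigma> \<otimes> \<tau> \<Longrightarrow> \<Gamma> \<turnstile> e \<approx> Tup (Fst e) (Snd e) \<Colon> \<sigma> \<otimes> \<tau>"
| Rcd_beta: "\<Gamma> \<turnstile> Rcd fs \<Colon> RecT Fs \<Longrightarrow> fmlookup fs l = Some e \<Longrightarrow> fmlookup Fs l = Some \<tau> \<Longrightarrow>
    \<Gamma> \<turnstile> Sel (Rcd fs) l \<approx> e \<Colon> \<tau>"
| Rcd_eta: "\<Gamma> \<turnstile> e \<Colon> RecT Fs \<Longrightarrow> \<Gamma> \<turnstile> e \<approx> Rcd (fmmap_keys (\<lambda>l _. Sel e l) Fs) \<Colon> RecT Fs"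
  \<comment> \<open>integer arithmetic\<close>
| Plus_assoc: "\<Gamma> \<turnstile> e \<Colon> IntT \<Longrightarrow> \<Gamma> \<turnstile> e' \<Colon> IntT \<Longrightarrow> \<Gamma> \<turnstile> e'' \<Colon> IntT \<Longrightarrow>
    \<Gamma> \<turnstile> Plus (Plus e e') e'' \<approx> Plus e (Plus e' e'') \<Colon> IntT"
| Plus_commute: "\<Gamma> \<turnstile> e \<Colon> IntT \<Longrightarrow> \<Gamma> \<turnstile> e' \<Colon> IntT \<Longrightarrow> \<Gamma> \<turnstile> Plus e e' \<approx> Plus e' e \<Colon> IntT"
| Plus_zero: "\<Gamma> \<turnstile> e \<Colon> IntT \<Longrightarrow> \<Gamma> \<turnstile> Plus e (Lit 0) \<approx> e \<Colon> IntT"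
| Plus_neg: "\<Gamma> \<turnstile> e \<Colon> IntT \<Longrightarrow> \<Gamma> \<turnstile> Plus e (App Neg e) \<approx> Lit 0 \<Colon> IntT"
| Minus_eq: "\<Gamma> \<turnstile> e \<Colon> IntT \<Longrightarrow> \<Gamma> \<turnstile> e' \<Colon> IntT \<Longrightarrow> \<Gamma> \<turnstile> Minus e e' \<approx> Plus e (App Neg e') \<Colon> IntT"
| Plus_Lit: "\<Gamma> \<turnstile> Plus (Lit j) (Lit k) \<approx> Lit (j + k) \<Colon> IntT"
  \<comment> \<open>monad laws\<close>
| Bind_Ret: "\<Gamma> \<turnstile> e \<Colon> \<sigma> \<Longrightarrow> \<sigma> # \<Gamma> \<turnstile> e' \<Colon> T \<tau> \<Longrightarrow> \<Gamma> \<turnstile> Bind (Ret e) e' \<approx> inst e e' \<Colon> T \<tau>"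
| Ret_Bind: "\<Gamma> \<turnstile> e \<Colon> T \<sigma> \<Longrightarrow> \<Gamma> \<turnstile> Bind e (Ret (Var 0)) \<approx> e \<Colon> T \<sigma>"
| Bind_assoc: "\<Gamma> \<turnstile> e \<Colon> T \<rho> \<Longrightarrow> \<rho> # \<Gamma> \<turnstile> e' \<Colon> T \<sigma> \<Longrightarrow> \<sigma> # \<Gamma> \<turnstile> e'' \<Colon> T \<tau> \<Longrightarrow>
    \<Gamma> \<turnstile> Bind (Bind e e') e'' \<approx> Bind e (Bind e' (rename (lift_ren Suc) e'')) \<Colon> T \<tau>"
  \<comment> \<open>steps and recursion\<close>
| Step_central: "\<Gamma> \<turnstile> e \<Colon> T \<sigma> \<Longrightarrow> \<sigma> # \<Gamma> \<turnstile> e' \<Colon> T \<tau> \<Longrightarrow>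
    \<Gamma> \<turnstile> Step ;; Bind e e' \<approx> Bind e (Step ;; e') \<Colon> T \<tau>"
| Rec_unfold: "\<sigma> # (\<sigma> \<rightarrow> T \<tau>) # \<Gamma> \<turnstile> e \<Colon> T \<tau> \<Longrightarrow> \<Gamma> \<turnstile> e' \<Colon> \<sigma> \<Longrightarrow>
    \<Gamma> \<turnstile> App (Rec \<sigma> \<tau> e) e' \<approx> Step ;; inst2 (Rec \<sigma> \<tau> e) e' e \<Colon> T \<tau>"
  \<comment> \<open>references\<close>
| set_get: "\<Gamma> \<turnstile> e \<Colon> Ref \<sigma> \<Longrightarrow> \<Gamma> \<turnstile> e' \<Colon> \<sigma> \<Longrightarrow>
    \<Gamma> \<turnstile> Set e e' ;; Get e \<approx> Step ;; Set e e' ;; Ret e' \<Colon> T \<sigma>"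
| alloc_set: "\<Gamma> \<turnstile> e \<Colon> \<sigma> \<Longrightarrow>
    \<Gamma> \<turnstile> Bind (Alloc e) (Set (Var 0) (shift e) ;; Ret (Var 0)) \<approx> Alloc e \<Colon> T (Ref \<sigma>)"
| set_set: "\<Gamma> \<turnstile> e \<Colon> Ref \<sigma> \<Longrightarrow> \<Gamma> \<turnstile> e' \<Colon> \<sigma> \<Longrightarrow> \<Gamma> \<turnstile> e'' \<Colon> \<sigma> \<Longrightarrow>
    \<Gamma> \<turnstile> Set e e' ;; Set e e'' \<approx> Set e e'' \<Colon> T UnitT"
| get_get: "\<Gamma> \<turnstile> e \<Colon> Ref \<sigma> \<Longrightarrow> \<Gamma> \<turnstile> e' \<Colon> Ref \<tau> \<Longrightarrow>
    \<Gamma> \<turnstile> Bind (Get e) (Bind (Get (shift e')) (Ret (Tup (Var 1) (Var 0))))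
      \<approx> Bind (Get e') (Bind (Get (shift e)) (Ret (Tup (Var 0) (Var 1)))) \<Colon> T (\<sigma> \<otimes> \<tau>)"
| get_set: "\<Gamma> \<turnstile> e \<Colon> Ref \<sigma> \<Longrightarrow>
    \<Gamma> \<turnstile> Bind (Get e) (Set (shift e) (Var 0) ;; Ret (Var 0)) \<approx> Get e \<Colon> T \<sigma>"
| get_discard: "\<Gamma> \<turnstile> e \<Colon> Ref \<sigma> \<Longrightarrow> \<Gamma> \<turnstile> e' \<Colon> T \<tau> \<Longrightarrow> \<Gamma> \<turnstile> Get e ;; e' \<approx> Step ;; e' \<Colon> T \<tau>"
  \<comment> \<open>univalent reference types\<close>
| alloc_perm: "\<Gamma> \<turnstile> e \<Colon> \<sigma> \<Longrightarrow> \<Gamma> \<turnstile> e' \<Colon> \<tau> \<Longrightarrow>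
    \<Gamma> \<turnstile> Bind (Alloc e) (Bind (Alloc (shift e')) (Ret (Tup (Var 1) (Var 0))))
      \<approx> Bind (Alloc e') (Bind (Alloc (shift e)) (Ret (Tup (Var 0) (Var 1)))) \<Colon> T (Ref \<sigma> \<otimes> Ref \<tau>)"
| rep_indep: "\<Gamma> \<turnstile> e \<Colon> \<sigma> \<Longrightarrow> \<Gamma> \<turnstile> fp \<Colon> \<sigma> \<rightarrow> \<tau> \<Longrightarrow> \<Gamma> \<turnstile> fm \<Colon> \<tau> \<rightarrow> \<sigma> \<Longrightarrow>
    \<tau> # \<Gamma> \<turnstile> App (shift fp) (App (shift fm) (Var 0)) \<approx> Var 0 \<Colon> \<tau> \<Longrightarrow>
    \<sigma> # \<Gamma> \<turnstile> App (shift fm) (App (shift fp) (Var 0)) \<approx> Var 0 \<Colon> \<sigma> \<Longrightarrow>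
    \<Gamma> \<turnstile> Bind (Alloc e) (Ret (Tup (Get (Var 0)) (setf \<sigma> (Var 0))))
      \<approx> Bind (Alloc (App fp e))
          (Ret (Tup (mapT (shift fm) (Get (Var 0))) (comp \<sigma> (setf \<tau> (Var 0)) (shift fp))))
      \<Colon> T (Cell \<sigma>)"

section \<open>The counters\<close>

definition Counter :: ty where
  "Counter = RecT (fmap_of_list [(''incr'', T UnitT), (''read'', T IntT)])"

definition posCounter :: tm where
  "posCounter = Bind (Alloc (Lit 0)) (Ret (Rcd (fmap_of_list
     [(''incr'', Bind (Get (Var 0)) (Set (Var 1) (Plus (Var 0) (Lit 1)))),
      (''read'', Get (Var 0))])))"

definition negCounter :: tm where
  "negCounter = Bind (Alloc (Lit 0)) (Ret (Rcd (fmap_of_list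
     [(''incr'', Bind (Get (Var 0)) (Set (Var 1) (Minus (Var 0) (Lit 1)))),
      (''read'', mapT Neg (Get (Var 0)))])))"

end

theory Submission
  imports Defs
begin

text \<open>
  Both counters arise by applying one and the same client to a cell: a client can only read
  through the first component of the cell and write through the second.  Representation
  independence along the involution \<open>neg\<close> exchanges the cell of a reference initialised
  with \<open>0\<close> for the negated cell of a reference initialised with \<open>neg 0 \<equiv> 0\<close>; incrementing
  the negated cell stores \<open>neg (neg i + 1) \<equiv> i - 1\<close>.
\<close>

declare equ.trans [trans]

lemma typing_rename:
  assumes "\<Gamma> \<turnstile> e \<Colon> \<tau>" "\<And>n. n < length \<Gamma> \<Longrightarrow> r n < length \<Delta> \<and> \<Delta> ! r n = \<Gamma> ! n"
  shows "\<Delta> \<turnstile> rename r e \<Colon> \<tau>"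
  using assms
proof (induction arbitrary: \<Delta> r rule: typing.induct)
  case (Var n \<Gamma>)
  then show ?case using typing.Var[of "r n" \<Delta>] by simp
next
  case (Rcd \<Gamma> fs Fs)
  have "fmrel (\<lambda>e \<tau>. \<Delta> \<turnstile> rename r e \<Colon> \<tau>) fs Fs"
    using Rcd.IH by (rule fmap.rel_mono_strong) (use Rcd.prems in blast)
  then show ?case by (simp add: typing.Rcd fmap.rel_map)
next
  case (Lam \<sigma> \<Gamma> e \<tau>)
  show ?case
    by (auto intro!: typing.Lam Lam.IH simp: Lam.prems lift_ren_def split: nat.splits)
next
  case (Bind \<Gamma> e \<sigma> e' \<tau>)
  show ?case
    by (auto intro!: typing.Bind[where \<sigma> = \<sigma>] Bind.IH simp: Bind.prems lift_ren_def split: nat.splits)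
next
  case (Rec \<sigma> \<tau> \<Gamma> e)
  show ?case
    by (auto intro!: typing.Rec Rec.IH simp: Rec.prems lift_ren_def split: nat.splits)
qed (auto intro: typing.intros, (blast intro: typing.App typing.Set)+)

lemma typing_shift: "\<Gamma> \<turnstile> e \<Colon> \<tau> \<Longrightarrow> \<sigma> # \<Gamma> \<turnstile> shift e \<Colon> \<tau>"
  by (erule typing_rename) simp

text \<open>The rule \<open>typing.Var\<close> yields the type as a lookup
  \<open>\<Gamma> ! n\<close>, which resolution does not evaluate; this instance and the next give
  it in evaluated form.\<close>

lemma typing_Var0: "\<sigma> # \<Gamma> \<turnstile> Var 0 \<Colon> \<sigma>"
  using typing.Var[of 0 "\<sigma> # \<Gamma>"] by simp

lemma typing_Var1: "\<sigma> # \<tau> # \<Gamma> \<turnstile> Var (Suc 0) \<Colon> \<tau>"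
  using typing.Var[of "Suc 0" "\<sigma> # \<tau> # \<Gamma>"] by simp

lemma typing_setf: "\<Gamma> \<turnstile> e \<Colon> Ref \<sigma> \<Longrightarrow> \<Gamma> \<turnstile> setf \<sigma> e \<Colon> \<sigma> \<rightarrow> T UnitT"
  unfolding setf_def by (rule typing.Lam typing.Set typing_shift typing_Var0 | assumption)+

lemma typing_mapT: "\<Gamma> \<turnstile> f \<Colon> \<sigma> \<rightarrow> \<tau> \<Longrightarrow> \<Gamma> \<turnstile> e \<Colon> T \<sigma> \<Longrightarrow> \<Gamma> \<turnstile> mapT f e \<Colon> T \<tau>"
  unfolding mapT_def by (rule typing.Bind typing.Ret typing.App typing_shift typing_Var0 | assumption)+

lemma typing_comp: "\<Gamma> \<turnstile> g \<Colon> \<tau> \<rightarrow> \<rho> \<Longrightarrow> \<Gamma> \<turnstile> f \<Colon> \<sigma> \<rightarrow> \<tau> \<Longrightarrow> \<Gamma> \<turnstile> comp \<sigma> g f \<Colon> \<sigma> \<rightarrow> \<rho>"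
  unfolding comp_def by (rule typing.Lam typing.App typing_shift typing_Var0 | assumption)+

lemmas typing_intros = typing.App typing.Tup typing.Lit typing.Plus typing.Minus typing.Neg
  typing.Ret typing.Bind typing.Alloc typing.Get typing.Set
  typing_Var0 typing_Var1 typing_setf typing_mapT typing_comp

text \<open>Associativity brings \<open>Ret d\<close> directly before \<open>e'\<close>, where the
  left unit law substitutes it away. The renaming \<open>lift_ren Suc\<close> keeps index 0 of
  \<open>e'\<close> and makes room above it for the variable bound to the result of
  \<open>e\<close>. This serves both to feed a pair to the client and to absorb
  \<open>mapT\<close>.\<close>

lemma Bind_Bind_Ret:
  assumes "\<Gamma> \<turnstile> e \<Colon> T \<rho>" "\<rho> # \<Gamma> \<turnstile> d \<Colon> \<sigma>" "\<sigma> # \<Gamma> \<turnstile> e' \<Colon> T \<tau>"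
  shows "\<Gamma> \<turnstile> Bind (Bind e (Ret d)) e' \<approx> Bind e (inst d (rename (lift_ren Suc) e')) \<Colon> T \<tau>"
proof -
  have e'': "\<sigma> # \<rho> # \<Gamma> \<turnstile> rename (lift_ren Suc) e' \<Colon> T \<tau>"
    using assms(3) by (rule typing_rename) (auto simp: lift_ren_def split: nat.splits)
  have "\<Gamma> \<turnstile> Bind e (Bind (Ret d) (rename (lift_ren Suc) e'))
      \<approx> Bind e (inst d (rename (lift_ren Suc) e')) \<Colon> T \<tau>"
    by (rule equ.cong_Bind equ.Bind_Ret equ.refl assms e'')+
  with equ.Bind_assoc[OF assms(1) typing.Ret[OF assms(2)] assms(3)] show ?thesis
    by (rule equ.trans)
qed

text \<open>Uniqueness of inverses: insert \<open>Plus a b\<close> to the right of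
  \<open>App Neg a\<close>, reassociate and cancel. The only arithmetic axioms mentioning
  \<open>Neg\<close> are \<open>Plus_neg\<close> and \<open>Minus_eq\<close>, so the identities for
  \<open>Neg\<close> below are all drawn from this lemma.\<close>

lemma Neg_unique:
  assumes a: "\<Gamma> \<turnstile> a \<Colon> IntT" and b: "\<Gamma> \<turnstile> b \<Colon> IntT"
    and ab: "\<Gamma> \<turnstile> Plus a b \<approx> Lit 0 \<Colon> IntT"
  shows "\<Gamma> \<turnstile> App Neg a \<approx> b \<Colon> IntT"
proof -
  note n = typing.App[OF typing.Neg a]
  have "\<Gamma> \<turnstile> App Neg a \<approx> Plus (App Neg a) (Lit 0) \<Colon> IntT"
    by (rule equ.sym[OF equ.Plus_zero] n)+
  also have "\<Gamma> \<turnstile> Plus (App Neg a) (Lit 0) \<approx> Plus (App Neg a) (Plus a b) \<Colon> IntT"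
    by (rule equ.cong_Plus equ.sym[OF ab] equ.refl n)+
  also have "\<Gamma> \<turnstile> Plus (App Neg a) (Plus a b) \<approx> Plus (Plus (App Neg a) a) b \<Colon> IntT"
    by (rule equ.sym[OF equ.Plus_assoc] a b n)+
  also have "\<Gamma> \<turnstile> Plus (Plus (App Neg a) a) b \<approx> Plus (Lit 0) b \<Colon> IntT"
    by (rule equ.cong_Plus equ.trans[OF equ.Plus_commute equ.Plus_neg] equ.refl a b n)+
  also have "\<Gamma> \<turnstile> Plus (Lit 0) b \<approx> b \<Colon> IntT"
    by (rule equ.trans[OF equ.Plus_commute equ.Plus_zero] typing.Lit b)+
  finally show ?thesis .
qed

lemma Neg_Lit0: "\<Gamma> \<turnstile> App Neg (Lit 0) \<approx> Lit 0 \<Colon> IntT"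
  by (rule Neg_unique equ.Plus_zero typing.Lit)+

lemma Neg_Neg:
  assumes "\<Gamma> \<turnstile> a \<Colon> IntT"
  shows "\<Gamma> \<turnstile> App Neg (App Neg a) \<approx> a \<Colon> IntT"
  by (rule Neg_unique equ.trans[OF equ.Plus_commute equ.Plus_neg] typing.App[OF typing.Neg] assms)+

text \<open>For \<open>b\<close> the literal 1 this identifies what incrementing the negated cell
  stores. By uniqueness of inverses it suffices that the two sums cancel: reassociation cancels
  first \<open>a\<close>, then \<open>b\<close>.\<close>

lemma Neg_Plus_Neg:
  assumes a: "\<Gamma> \<turnstile> a \<Colon> IntT" and b: "\<Gamma> \<turnstile> b \<Colon> IntT"
  shows "\<Gamma> \<turnstile> App Neg (Plus (App Neg a) b) \<approx> Minus a b \<Colon> IntT"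
proof (rule Neg_unique)
  note na = typing.App[OF typing.Neg a] and nb = typing.App[OF typing.Neg b]
  note t = a b na nb typing.Plus typing.Minus typing.Lit equ.refl
  have "\<Gamma> \<turnstile> Plus (Plus (App Neg a) b) (Minus a b)
      \<approx> Plus (Plus b (App Neg a)) (Plus a (App Neg b)) \<Colon> IntT"
    by (rule equ.cong_Plus equ.Plus_commute equ.Minus_eq t)+
  also have "\<Gamma> \<turnstile> Plus (Plus b (App Neg a)) (Plus a (App Neg b))
      \<approx> Plus b (Plus (App Neg a) (Plus a (App Neg b))) \<Colon> IntT"
    by (rule equ.Plus_assoc t)+
  also have "\<Gamma> \<turnstile> Plus b (Plus (App Neg a) (Plus a (App Neg b)))
      \<approx> Plus b (Plus (Plus (App Neg a) a) (App Neg b)) \<Colon> IntT"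
    by (rule equ.cong_Plus equ.sym[OF equ.Plus_assoc] t)+
  also have "\<Gamma> \<turnstile> Plus b (Plus (Plus (App Neg a) a) (App Neg b))
      \<approx> Plus b (Plus (Lit 0) (App Neg b)) \<Colon> IntT"
    by (rule equ.cong_Plus equ.trans[OF equ.Plus_commute equ.Plus_neg] t)+
  also have "\<Gamma> \<turnstile> Plus b (Plus (Lit 0) (App Neg b)) \<approx> Plus b (App Neg b) \<Colon> IntT"
    by (rule equ.cong_Plus equ.trans[OF equ.Plus_commute equ.Plus_zero] t)+
  also have "\<Gamma> \<turnstile> Plus b (App Neg b) \<approx> Lit 0 \<Colon> IntT"
    by (rule equ.Plus_neg t)+
  finally show "\<Gamma> \<turnstile> Plus (Plus (App Neg a) b) (Minus a b) \<approx> Lit 0 \<Colon> IntT" .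
qed (rule typing_intros a b)+

text \<open>Hides the finite map, so that renaming, substitution, congruence and typing act on the
  two fields directly.\<close>

definition counter_record :: "tm \<Rightarrow> tm \<Rightarrow> tm" where
  "counter_record i r = Rcd (fmap_of_list [(''incr'', i), (''read'', r)])"

lemma rename_counter_record: "rename r (counter_record i e) = counter_record (rename r i) (rename r e)"
  and subst_counter_record: "subst s (counter_record i e) = counter_record (subst s i) (subst s e)"
  by (simp_all add: counter_record_def fmmap_fmupd)

lemma cong_counter_record:
  assumes "\<Gamma> \<turnstile> i \<approx> i' \<Colon> T UnitT" "\<Gamma> \<turnstile> r \<approx> r' \<Colon> T IntT"
  shows "\<Gamma> \<turnstile> counter_record i r \<approx> counter_record i' r' \<Colon> Counter"
  unfolding counter_record_def Counter_def
  by (rule equ.cong_Rcd) (use assms in \<open>auto simp: fmlookup_of_list split: if_splits\<close>)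

lemma typing_counter_record:
  assumes "\<Gamma> \<turnstile> i \<Colon> T UnitT" "\<Gamma> \<turnstile> r \<Colon> T IntT"
  shows "\<Gamma> \<turnstile> counter_record i r \<Colon> Counter"
  unfolding counter_record_def Counter_def
  by (rule typing.Rcd) (use assms in \<open>auto simp: fmrel_iff fmlookup_of_list\<close>)

text \<open>Here \<open>c\<close> is the reading and \<open>s\<close> the writing component of a
  cell. The reference itself does not occur as an argument, so the same term serves for the plain
  and for the negated cell.\<close>

definition counter :: "tm \<Rightarrow> tm \<Rightarrow> tm" where
  "counter c s = counter_record (Bind c (App (shift s) (Plus (Var 0) (Lit 1)))) c"

lemma typing_client:
  "Cell IntT # \<Gamma> \<turnstile> Ret (counter (Fst (Var 0)) (Snd (Var 0))) \<Colon> T Counter"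
  unfolding counter_def Cell_def rename.simps
  by (rule typing_intros typing_counter_record typing.Fst typing.Snd)+

text \<open>The pair is substituted into the client by \<open>Bind_Bind_Ret\<close>, and the
  projections then reduce by the beta laws for products.\<close>

lemma client_cell:
  assumes "\<Gamma> \<turnstile> e \<Colon> T \<rho>" and c: "\<rho> # \<Gamma> \<turnstile> c \<Colon> T IntT" and s: "\<rho> # \<Gamma> \<turnstile> s \<Colon> IntT \<rightarrow> T UnitT"
  shows "\<Gamma> \<turnstile> Bind (Bind e (Ret (Tup c s))) (Ret (counter (Fst (Var 0)) (Snd (Var 0))))
    \<approx> Bind e (Ret (counter c s)) \<Colon> T Counter"
proof -
  from assms(1) typing.Tup[OF c s] typing_client[unfolded Cell_def]
  have "\<Gamma> \<turnstile> Bind (Bind e (Ret (Tup c s))) (Ret (counter (Fst (Var 0)) (Snd (Var 0))))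
    \<approx> Bind e (inst (Tup c s) (rename (lift_ren Suc) (Ret (counter (Fst (Var 0)) (Snd (Var 0))))))
    \<Colon> T Counter"
    by (rule Bind_Bind_Ret)
  \<comment> \<open>The second copy of the pair is shifted because it lands under the binder of the
    increment.\<close>
  also have "inst (Tup c s) (rename (lift_ren Suc) (Ret (counter (Fst (Var 0)) (Snd (Var 0)))))
    = Ret (counter_record (Bind (Fst (Tup c s)) (App (Snd (Tup (shift c) (shift s))) (Plus (Var 0) (Lit 1))))
        (Fst (Tup c s)))"
    by (simp add: counter_def rename_counter_record subst_counter_record lift_ren_def lift_sub_def)
  \<comment> \<open>The type of the component that a projection discards does not occur in the
    conclusion of the beta law, so it is instantiated explicitly.\<close>
  also have "\<Gamma> \<turnstile> Bind e \<dots> \<approx> Bind e (Ret (counter c s)) \<Colon> T Counter"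
    unfolding counter_def
    by (rule equ.cong_Bind equ.cong_Ret cong_counter_record equ.cong_App
        equ.Prod_beta1[where \<tau> = "IntT \<rightarrow> T UnitT"] equ.Prod_beta2[where \<sigma> = "T IntT"]
        equ.refl assms typing_shift typing_intros)+
  finally show ?thesis .
qed

text \<open>With the reference restricted to a variable, simplification computes the instantiated
  body outright; no general fact that instantiation cancels \<open>shift\<close> enters.\<close>

lemma setf_beta:
  assumes "\<Gamma> \<turnstile> Var n \<Colon> Ref \<sigma>" "\<Gamma> \<turnstile> d \<Colon> \<sigma>"
  shows "\<Gamma> \<turnstile> App (setf \<sigma> (Var n)) d \<approx> Set (Var n) d \<Colon> T UnitT"
  using equ.Fun_beta[OF typing.Set[OF typing_shift[OF assms(1)] typing_Var0] assms(2)]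
  by (simp add: setf_def)

text \<open>Two beta steps, first through \<open>comp\<close> and then through \<open>setf\<close>:
  the writer of the negated cell negates before storing.\<close>

lemma comp_setf_Neg_beta:
  assumes n: "\<Gamma> \<turnstile> Var n \<Colon> Ref IntT" and d: "\<Gamma> \<turnstile> d \<Colon> IntT"
  shows "\<Gamma> \<turnstile> App (comp IntT (setf IntT (Var n)) Neg) d \<approx> Set (Var n) (App Neg d) \<Colon> T UnitT"
proof -
  have "IntT # \<Gamma> \<turnstile> App (setf IntT (Var (Suc n))) (App Neg (Var 0)) \<Colon> T UnitT"
    by (rule typing_intros typing_shift[OF n, unfolded rename.simps])+
  from equ.Fun_beta[OF this d]
  have "\<Gamma> \<turnstile> App (comp IntT (setf IntT (Var n)) Neg) d \<approx> App (setf IntT (Var n)) (App Neg d) \<Colon> T UnitT"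
    by (simp add: comp_def setf_def lift_sub_def lift_ren_def)
  also have "\<Gamma> \<turnstile> App (setf IntT (Var n)) (App Neg d) \<approx> Set (Var n) (App Neg d) \<Colon> T UnitT"
    by (rule setf_beta n typing_intros d)+
  finally show ?thesis .
qed

text \<open>The readers agree literally; only the write inside the increment needs a beta
  step.\<close>

lemma posCounter_cell:
  "\<Gamma> \<turnstile> Bind (Alloc (Lit 0)) (Ret (counter (Get (Var 0)) (setf IntT (Var 0))))
    \<approx> posCounter \<Colon> T Counter"
proof -
  have shift: "shift (setf IntT (Var 0)) = setf IntT (Var (Suc 0))"
    by (simp add: setf_def lift_ren_def)
  show ?thesis
    \<comment> \<open>Folding \<open>counter_record\<close> exposes the record of
      \<open>posCounter\<close> to its congruence lemma, and \<open>One_nat_def\<close> turns the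
      index 1 into the form used by \<open>typing_Var1\<close>; the integer in \<open>Lit 1\<close>
      is unaffected.\<close>
    unfolding posCounter_def counter_def shift counter_record_def[symmetric] One_nat_def
    by (rule equ.cong_Bind equ.cong_Ret cong_counter_record setf_beta equ.refl typing_intros)+
qed

text \<open>The readers again agree literally. The initial values agree by \<open>Neg_Lit0\<close>,
  and the increments are treated separately: reduce the write, absorb the negation of the value
  read, then simplify the stored integer.\<close>

lemma negCounter_cell:
  "\<Gamma> \<turnstile> Bind (Alloc (App Neg (Lit 0)))
      (Ret (counter (mapT Neg (Get (Var 0))) (comp IntT (setf IntT (Var 0)) Neg)))
    \<approx> negCounter \<Colon> T Counter"
proof -
  let ?\<Delta> = "Ref IntT # \<Gamma>"
  let ?n = "Suc 0"
  have shift: "shift (comp IntT (setf IntT (Var 0)) Neg) = comp IntT (setf IntT (Var ?n)) Neg"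
    by (simp add: comp_def setf_def lift_ren_def)
  have "?\<Delta> \<turnstile> Bind (mapT Neg (Get (Var 0)))
        (App (comp IntT (setf IntT (Var ?n)) Neg) (Plus (Var 0) (Lit 1)))
      \<approx> Bind (mapT Neg (Get (Var 0))) (Set (Var ?n) (App Neg (Plus (Var 0) (Lit 1)))) \<Colon> T UnitT"
    by (rule equ.cong_Bind comp_setf_Neg_beta equ.refl typing_intros)+
  \<comment> \<open>\<open>mapT\<close> is itself a bind ending in \<open>Ret\<close>, so the
    negation moves into the value written.\<close>
  also have "?\<Delta> \<turnstile> Bind (mapT Neg (Get (Var 0))) (Set (Var ?n) (App Neg (Plus (Var 0) (Lit 1))))
      \<approx> Bind (Get (Var 0))
      (inst (App Neg (Var 0)) (rename (lift_ren Suc) (Set (Var ?n) (App Neg (Plus (Var 0) (Lit 1))))))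
      \<Colon> T UnitT"
    unfolding mapT_def rename.simps(13)
    by (rule Bind_Bind_Ret typing_intros)+
  also have "inst (App Neg (Var 0)) (rename (lift_ren Suc) (Set (Var ?n) (App Neg (Plus (Var 0) (Lit 1)))))
      = Set (Var ?n) (App Neg (Plus (App Neg (Var 0)) (Lit 1)))"
    by (simp add: lift_ren_def)
  also have "?\<Delta> \<turnstile> Bind (Get (Var 0)) \<dots> \<approx> Bind (Get (Var 0)) (Set (Var ?n) (Minus (Var 0) (Lit 1)))
      \<Colon> T UnitT"
    by (rule equ.cong_Bind equ.cong_Set Neg_Plus_Neg equ.refl typing_intros)+
  finally have incr: "?\<Delta> \<turnstile> Bind (mapT Neg (Get (Var 0)))
        (App (comp IntT (setf IntT (Var ?n)) Neg) (Plus (Var 0) (Lit 1)))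
      \<approx> Bind (Get (Var 0)) (Set (Var ?n) (Minus (Var 0) (Lit 1))) \<Colon> T UnitT" .
  show ?thesis
    unfolding negCounter_def counter_def shift counter_record_def[symmetric] One_nat_def
    by (rule equ.cong_Bind equ.cong_Alloc equ.cong_Ret cong_counter_record incr Neg_Lit0 equ.refl typing_intros)+
qed

theorem mainTheorem1:
  shows "[] \<turnstile> posCounter \<approx> negCounter \<Colon> T Counter"
proof -
  let ?client = "Ret (counter (Fst (Var 0)) (Snd (Var 0)))"
  let ?pos = "Bind (Alloc (Lit 0)) (Ret (Tup (Get (Var 0)) (setf IntT (Var 0))))"
  let ?neg = "Bind (Alloc (App Neg (Lit 0)))
    (Ret (Tup (mapT Neg (Get (Var 0))) (comp IntT (setf IntT (Var 0)) Neg)))"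
  have involution: "[IntT] \<turnstile> App Neg (App Neg (Var 0)) \<approx> Var 0 \<Colon> IntT"
    by (rule Neg_Neg typing_intros)+
  \<comment> \<open>Both directions of the isomorphism are \<open>Neg\<close> on
    \<open>IntT\<close>, so one equation discharges both inverse laws; \<open>rename.simps\<close>
    removes the shifts of the closed term \<open>Neg\<close>.\<close>
  have cells: "[] \<turnstile> ?pos \<approx> ?neg \<Colon> T (Cell IntT)"
    using equ.rep_indep[OF typing.Lit typing.Neg typing.Neg, unfolded rename.simps, OF involution involution] .
  have client: "[Cell IntT] \<turnstile> ?client \<Colon> T Counter"
    by (rule typing_client)
  have "[] \<turnstile> posCounter \<approx> Bind ?pos ?client \<Colon> T Counter"
    by (rule equ.sym[OF equ.trans[OF client_cell posCounter_cell]] typing_intros)+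
  also have "[] \<turnstile> Bind ?pos ?client \<approx> Bind ?neg ?client \<Colon> T Counter"
    by (rule equ.cong_Bind cells equ.refl client)+
  also have "[] \<turnstile> Bind ?neg ?client \<approx> negCounter \<Colon> T Counter"
    by (rule equ.trans[OF client_cell negCounter_cell] typing_intros)+
  finally show ?thesis .
qed

end
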